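(* For all integers $m\geq 2$ and $k\in\mathbb N$, $$\zeta_{\mathcal P}(\{m\}^k)=\pi^{mk}\,[z^{mk}]\prod_{r=0}^{m-1}\Gamma\left(1-\frac{z}{\pi}e(r/m)\right)=\pi^{mk}\,[z^{mk}]\exp\left(\sum_{j\geq1}\frac{\zeta(mj)}{j}\left(\frac{z}{\pi}\right)^{mj}\right).$$
   Context: $\mathbb N=\{1,2,3,\dots\}$, $e(x):=e^{2\pi i x}$, $\Gamma$ is Euler's gamma function, $\zeta$ is the Riemann zeta function, and $[z^n]f$ denotes the coefficient of $z^n$ in the power series (Taylor expansion at $z=0$) of $f$. For a partition $\lambda=(\lambda_1\geq\dots\geq\lambda_r\geq 1)$, its length is $\ell(\lambda)=r$ and $n_\lambda:=\lambda_1\cdots\lambda_r$ is the product of its parts. For $\operatorname{Re}(s)>1$ and $k\geq0$, $\zeta_{\mathcal P}(\{s\}^k):=\sum_{\ell(\lambda)=k}n_\lambda^{-s}$, the sum being over all integer partitions $\lambda$ of length $k$; equivalently $\zeta_{\mathcal P}(\{m\}^k)=\sum_{n_1\geq n_2\geq\dots\geq n_k\geq1}(n_1n_2\cdots n_k)^{-m}$. *)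

theory Defs
  imports "HOL-Complex_Analysis.Complex_Analysis"
begin

definition ee :: "real \<Rightarrow> complex" where
  "ee x = exp (2 * of_real pi * \<i> * of_real x)"

text \<open>
  The Dirichlet series of the Riemann zeta function. It represents the zeta function only
  for \<open>Re s > 1\<close>; no analytic continuation is involved.
\<close>
definition zeta :: "complex \<Rightarrow> complex" where
  "zeta s = (\<Sum>\<^sub>\<infinity>n\<in>{1::nat..}. of_nat n powr (- s))"

text \<open>An integer partition is the list of its parts, each at least 1, in weakly decreasing order.\<close>
definition integer_partition :: "nat list \<Rightarrow> bool" where
  "integer_partition ps \<longleftrightarrow> sorted_wrt (\<ge>) ps \<and> (\<forall>p\<in>set ps. p \<ge> 1)"

text \<open>
  \<open>zeta_P s k\<close> is the partition zeta value at \<open>{s}\<^sup>k\<close>, meaningful for \<open>Re s > 1\<close>.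
  The product of the parts is \<open>prod_list ps\<close>.
\<close>
definition zeta_P :: "complex \<Rightarrow> nat \<Rightarrow> complex" where
  "zeta_P s k =
     (\<Sum>\<^sub>\<infinity>ps\<in>{ps. integer_partition ps \<and> length ps = k}. of_nat (prod_list ps) powr (- s))"

definition taylor_coeff :: "nat \<Rightarrow> (complex \<Rightarrow> complex) \<Rightarrow> complex" where
  "taylor_coeff n f = fps_nth (fps_expansion f 0) n"

end

theory Submission
  imports
    Defs
    "HOL-Computational_Algebra.Fundamental_Theorem_Algebra"
begin

text \<open>
  All three expressions come from the product \<open>P w = (\<Prod>n\<ge>1. 1 / (1 - w ^ m / n ^ m))\<close> with
  \<open>w = z / \<pi>\<close>, through its partial products \<open>euler_prod m N\<close> over \<open>n \<le> N\<close>.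

  Expanding each factor as a geometric series, the coefficient of \<open>w ^ (m * k)\<close> in the partial product
  is the complete homogeneous symmetric polynomial of degree \<open>k\<close> in the numbers \<open>1 / n ^ m\<close> with
  \<open>n \<le> N\<close>, that is, the part of the sum defining \<open>zeta_P\<close> that comes from partitions with parts at
  most \<open>N\<close> (\<open>has_fps_expansion_prod_geometric\<close>).

  Euler's limit formula for \<open>Gamma\<close> together with
  \<open>(\<Prod>r<m. x - w * ee (r / m)) = x ^ m - w ^ m\<close> shows that the partial products tend to the product
  of the \<open>Gamma\<close> values (\<open>euler_prod_tendsto_gamma_prod\<close>). The exponential growth factors in the
  limit formula combine to \<open>N ^ m\<close> because the \<open>m\<close>-th roots of unity sum to zero for \<open>m \<ge> 2\<close>.
  The convergence is uniform near \<open>0\<close> (\<open>uniform_limit_euler_prod\<close>), so the Taylor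
  coefficients converge as well. This gives the first identity; the convergence of the coefficients
  also yields the summability of the series over all partitions, since its terms are nonnegative
  (\<open>zeta_P_eq_lim_complete_sym\<close>).

  For the second identity, take logarithms: \<open>- Ln (1 - u)\<close> is the sum of \<open>u ^ j / j\<close> over \<open>j \<ge> 1\<close>, and
  exchanging the sums over \<open>n\<close> and \<open>j\<close> turns the logarithm of the product into the zeta series
  (\<open>euler_prod_tendsto_exp\<close>). Both functions therefore agree near \<open>0\<close>.
\<close>

section \<open>Partitions with bounded parts and complete symmetric polynomials\<close>

text \<open>The partitions into exactly \<open>k\<close> parts, all of them at most \<open>N\<close>.\<close>

definition bounded_partitions :: "nat \<Rightarrow> nat \<Rightarrow> nat list set" where
  "bounded_partitions N k = {ps. integer_partition ps \<and> length ps = k \<and> set ps \<subseteq> {..N}}"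

text \<open>
  The complete homogeneous symmetric polynomial of degree \<open>k\<close>, evaluated at \<open>a 1, \<dots>, a N\<close>. A monomial
  is represented by the weakly decreasing list of its indices; \<open>a 0\<close> does not occur.
\<close>

definition complete_sym :: "(nat \<Rightarrow> 'a :: comm_ring_1) \<Rightarrow> nat \<Rightarrow> nat \<Rightarrow> 'a" where
  "complete_sym a N k = (\<Sum>ps\<in>bounded_partitions N k. prod_list (map a ps))"

lemma finite_bounded_partitions [simp]: "finite (bounded_partitions N k)"
  by (rule finite_subset[OF _ finite_lists_length_eq[of "{..N}" k]])
     (auto simp: bounded_partitions_def)

lemma bounded_partitions_0_right [simp]: "bounded_partitions N 0 = {[]}"
  by (auto simp: bounded_partitions_def integer_partition_def)

lemma bounded_partitions_0_left: "k > 0 \<Longrightarrow> bounded_partitions 0 k = {}"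
  by (auto simp: bounded_partitions_def integer_partition_def length_Suc_conv gr0_conv_Suc)

text \<open>
  A partition with largest part \<open>Suc N\<close> is that part followed by a partition with parts at most
  \<open>Suc N\<close>.
\<close>

lemma bounded_partitions_Suc:
  "bounded_partitions (Suc N) (Suc k) =
     bounded_partitions N (Suc k) \<union> (#) (Suc N) ` bounded_partitions (Suc N) k"
    (is "?A = ?B \<union> ?C")
proof (intro equalityI subsetI)
  fix ps assume ps: "ps \<in> ?A"
  then obtain p qs where [simp]: "ps = p # qs"
    by (auto simp: bounded_partitions_def length_Suc_conv)
  show "ps \<in> ?B \<union> ?C"
  proof (cases "p = Suc N")
    case True
    with ps show ?thesis
      by (auto simp: bounded_partitions_def integer_partition_def)
  next
    case False
    with ps have "p \<le> N" "\<forall>q\<in>set qs. q \<le> p"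
      by (auto simp: bounded_partitions_def integer_partition_def)
    with ps show ?thesis
      by (fastforce simp: bounded_partitions_def)
  qed
qed (auto simp: bounded_partitions_def integer_partition_def)

lemma complete_sym_0_right [simp]: "complete_sym a N 0 = 1"
  by (simp add: complete_sym_def)

lemma complete_sym_Suc:
  "complete_sym a (Suc N) (Suc k) =
     complete_sym a N (Suc k) + a (Suc N) * complete_sym a (Suc N) k"
proof -
  have "complete_sym a (Suc N) (Suc k) =
          complete_sym a N (Suc k) +
          (\<Sum>ps\<in>(#) (Suc N) ` bounded_partitions (Suc N) k. prod_list (map a ps))"
    unfolding complete_sym_def bounded_partitions_Suc
    by (rule sum.union_disjoint) (simp_all, auto simp: bounded_partitions_def)
  also have "(\<Sum>ps\<in>(#) (Suc N) ` bounded_partitions (Suc N) k. prod_list (map a ps)) =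
               a (Suc N) * complete_sym a (Suc N) k"
    by (subst sum.reindex) (auto simp: complete_sym_def sum_distrib_left)
  finally show ?thesis .
qed

lemma complete_sym_generating_function:
  fixes a :: "nat \<Rightarrow> 'a :: field"
  shows "Abs_fps (complete_sym a N) =
           (\<Prod>n<N. inverse (1 - fps_const (a (Suc n)) * fps_X))"
proof (induction N)
  case 0
  show ?case
    by (rule fps_ext) (simp add: complete_sym_def bounded_partitions_0_left)
next
  case (Suc N)
  define q where "q = 1 - fps_const (a (Suc N)) * fps_X"
  have "Abs_fps (complete_sym a (Suc N)) * q = Abs_fps (complete_sym a N)"
  proof (rule fps_ext)
    fix k show "(Abs_fps (complete_sym a (Suc N)) * q) $ k = Abs_fps (complete_sym a N) $ k"
    proof (cases k)
      case 0
      thus ?thesis by (simp add: q_def)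
    next
      case (Suc j)
      have "Abs_fps (complete_sym a (Suc N)) * q =
              Abs_fps (complete_sym a (Suc N)) -
                fps_X * (fps_const (a (Suc N)) * Abs_fps (complete_sym a (Suc N)))"
        unfolding q_def by (simp add: right_diff_distrib mult_ac)
      thus ?thesis by (simp add: Suc complete_sym_Suc)
    qed
  qed
  moreover have "q $ 0 \<noteq> 0" by (simp add: q_def)
  ultimately have "Abs_fps (complete_sym a (Suc N)) = Abs_fps (complete_sym a N) * inverse q"
    by (metis inverse_mult_eq_1' mult.assoc mult.right_neutral)
  with Suc.IH show ?case by (simp add: q_def)
qed

lemma has_fps_expansion_prod_geometric:
  fixes a :: "nat \<Rightarrow> complex"
  assumes "m > 0"
  shows "(\<lambda>w. \<Prod>n<N. inverse (1 - a (Suc n) * w ^ m)) has_fps_expansion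
           (Abs_fps (complete_sym a N) oo fps_X ^ m)"
proof -
  have "(\<lambda>x. \<Prod>n<N. inverse (1 - a (Suc n) * x)) has_fps_expansion Abs_fps (complete_sym a N)"
    unfolding complete_sym_generating_function
    by (intro fps_expansion_intros) auto
  hence "((\<lambda>x. \<Prod>n<N. inverse (1 - a (Suc n) * x)) \<circ> (\<lambda>w. w ^ m)) has_fps_expansion
           (Abs_fps (complete_sym a N) oo fps_X ^ m)"
    by (rule has_fps_expansion_compose) (use assms in \<open>auto intro: fps_expansion_intros\<close>)
  thus ?thesis by (simp add: o_def)
qed

section \<open>Taylor coefficients\<close>

lemma taylor_coeff_eqI: "f has_fps_expansion F \<Longrightarrow> taylor_coeff n f = fps_nth F n"
  by (simp add: taylor_coeff_def fps_expansion_eqI)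

lemma taylor_coeff_cong:
  assumes "eventually (\<lambda>z. f z = g z) (nhds 0)"
  shows "taylor_coeff n f = taylor_coeff n g"
  unfolding taylor_coeff_def using fps_expansion_cong[OF assms] by simp

lemma taylor_coeff_divide:
  assumes "f analytic_on {0}"
  shows "taylor_coeff n (\<lambda>z. f (z / c)) = taylor_coeff n f / c ^ n"
proof -
  have "(f \<circ> (\<lambda>z. inverse c * z)) has_fps_expansion
          (fps_expansion f 0 oo (fps_const (inverse c) * fps_X))"
    using assms
    by (intro has_fps_expansion_compose analytic_at_imp_has_fps_expansion_0 fps_expansion_intros) auto
  hence "taylor_coeff n (f \<circ> (\<lambda>z. inverse c * z)) =
           fps_nth (fps_expansion f 0 oo (fps_const (inverse c) * fps_X)) n"
    by (rule taylor_coeff_eqI)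
  also have "\<dots> = inverse c ^ n * taylor_coeff n f"
    by (simp add: fps_compose_linear taylor_coeff_def)
  finally show ?thesis
    by (simp add: o_def field_simps)
qed

section \<open>Roots of unity\<close>

lemma ee_eq_cis: "ee (real r / real m) = cis (2 * pi * real r / real m)"
  by (simp add: ee_def cis_conv_exp mult_ac)

lemma sum_ee_roots:
  assumes "m \<ge> 2"
  shows "(\<Sum>r<m. ee (real r / real m)) = 0"
proof -
  have "(\<Sum>r<m. ee (real r / real m)) = \<Sum>{z. z ^ m = 1}"
    unfolding ee_eq_cis
    by (rule sum.reindex_bij_betw[OF Complex.bij_betw_roots_unity]) (use assms in auto)
  with sum_roots_unity[of m] assms show ?thesis by simp
qed

lemma prod_diff_ee_roots:
  assumes "m > 0"
  shows "(\<Prod>r<m. x - w * ee (real r / real m)) = x ^ m - w ^ m"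
proof (cases "w = 0")
  case True
  with assms show ?thesis by simp
next
  case False
  define p :: "complex poly" where "p = monom 1 m - 1"
  have roots: "{z. poly p z = 0} = {z. z ^ m = 1}"
    by (simp add: p_def poly_monom)
  have lead: "lead_coeff p = 1"
  proof -
    have "degree p = m"
      using assms unfolding p_def diff_conv_add_uminus
      by (subst degree_add_eq_left) (auto simp: degree_monom_eq)
    with assms show ?thesis by (simp add: p_def)
  qed
  \<comment> \<open>The derivative \<open>m * z ^ (m - 1)\<close> vanishes at most at \<open>0\<close>, which is not a root.\<close>
  have "rsquarefree p"
    using assms
    by (auto simp: rsquarefree_roots p_def pderiv_diff pderiv_monom poly_monom power_0_left)
  from complex_poly_decompose_rsquarefree[OF this]
  have p: "p = (\<Prod>z\<in>{z. z ^ m = 1}. [:-z, 1:])"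
    by (simp add: lead roots)
  have "(\<Prod>r<m. x - w * ee (real r / real m)) = (\<Prod>z\<in>{z. z ^ m = 1}. x - w * z)"
    unfolding ee_eq_cis
    by (rule prod.reindex_bij_betw[OF Complex.bij_betw_roots_unity]) (use assms in auto)
  also have "\<dots> = (\<Prod>z\<in>{z. z ^ m = 1}. w * (x / w - z))"
    using False by (intro prod.cong refl) (simp add: right_diff_distrib)
  also have "\<dots> = w ^ m * (\<Prod>z\<in>{z. z ^ m = 1}. x / w - z)"
    using assms by (simp add: prod.distrib card_roots_unity_eq)
  also have "(\<Prod>z\<in>{z. z ^ m = 1}. x / w - z) = poly p (x / w)"
    unfolding p by (simp add: poly_prod)
  also have "w ^ m * poly p (x / w) = x ^ m - w ^ m"
    using False by (simp add: p_def poly_monom field_simps)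
  finally show ?thesis .
qed

section \<open>The product of Gamma functions as a limit of finite products\<close>

text \<open>
  The product of \<open>1 / (1 - w ^ m / n ^ m)\<close> over \<open>1 \<le> n \<le> N\<close>, with the index shifted by one. A factor
  whose denominator vanishes is \<open>0\<close>.
\<close>

definition euler_prod :: "nat \<Rightarrow> nat \<Rightarrow> complex \<Rightarrow> complex" where
  "euler_prod m N w = (\<Prod>n<N. inverse (1 - 1 / of_nat (Suc n) ^ m * w ^ m))"

text \<open>
  The product of Gamma functions, in the variable \<open>w = z / \<pi>\<close>. At poles \<open>Gamma\<close> takes the value \<open>0\<close>.
\<close>

definition gamma_prod :: "nat \<Rightarrow> complex \<Rightarrow> complex" where
  "gamma_prod m w = (\<Prod>r<m. Gamma (1 - w * ee (real r / real m)))"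

text \<open>
  \<open>Gamma_series y N\<close> is the approximation \<open>N! * N powr y / (y * (y + 1) * \<dots> * (y + N))\<close> of \<open>Gamma y\<close>.
  Its denominator has \<open>N + 1\<close> factors, hence the partial product up to \<open>Suc N\<close>.
\<close>

lemma prod_Gamma_series:
  assumes m: "m \<ge> 2" and N: "N > 0"
  shows "(\<Prod>r<m. Gamma_series (1 - w * ee (real r / real m)) N) =
           (of_nat N / of_nat (Suc N)) ^ m * euler_prod m (Suc N) w"
proof -
  let ?y = "\<lambda>r. 1 - w * ee (real r / real m)"
  have "(\<Prod>r<m. exp (?y r * of_real (ln (real N)))) =
          exp ((\<Sum>r<m. ?y r) * of_real (ln (real N)))"
    by (simp add: exp_sum sum_distrib_right)
  also have "(\<Sum>r<m. ?y r) = of_nat m"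
    using sum_ee_roots[OF m] by (simp add: sum_subtractf flip: sum_distrib_left)
  also have "exp (of_nat m * of_real (ln (real N))) = (of_nat N ^ m :: complex)"
    using N by (simp add: exp_of_nat_mult exp_of_real)
  finally have exps: "(\<Prod>r<m. exp (?y r * of_real (ln (real N)))) = of_nat N ^ m" .
  have "(\<Prod>r<m. pochhammer (?y r) (Suc N)) =
          (\<Prod>r<m. \<Prod>i<Suc N. of_nat (Suc i) - w * ee (real r / real m))"
    by (simp add: pochhammer_prod atLeast0LessThan algebra_simps del: prod.lessThan_Suc)
  also have "\<dots> = (\<Prod>i<Suc N. \<Prod>r<m. of_nat (Suc i) - w * ee (real r / real m))"
    by (rule prod.swap)
  also have "\<dots> = (\<Prod>i<Suc N. of_nat (Suc i) ^ m - w ^ m)"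
    using m by (intro prod.cong refl prod_diff_ee_roots) auto
  also have "\<dots> = (\<Prod>i<Suc N. of_nat (Suc i) ^ m * (1 - 1 / of_nat (Suc i) ^ m * w ^ m))"
    by (intro prod.cong refl) (simp add: field_simps del: of_nat_Suc)
  also have "\<dots> = (\<Prod>i<Suc N. of_nat (Suc i)) ^ m * inverse (euler_prod m (Suc N) w)"
    by (simp only: prod.distrib prod_power_distrib euler_prod_def prod_inversef [symmetric]
                   o_def inverse_inverse_eq)
  also have "(\<Prod>i<Suc N. of_nat (Suc i)) = (of_nat (Suc N) * fact N :: complex)"
    by (simp add: fact_prod_Suc atLeast0LessThan flip: of_nat_fact)
  finally have poch: "(\<Prod>r<m. pochhammer (?y r) (Suc N)) =
      (of_nat (Suc N) * fact N) ^ m * inverse (euler_prod m (Suc N) w)" .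
  have "(\<Prod>r<m. Gamma_series (?y r) N) =
          fact N ^ m * (\<Prod>r<m. exp (?y r * of_real (ln (real N)))) /
            (\<Prod>r<m. pochhammer (?y r) (Suc N))"
    by (simp add: Gamma_series_def prod_dividef prod.distrib)
  also have "\<dots> = (of_nat N / of_nat (Suc N)) ^ m * euler_prod m (Suc N) w"
    unfolding exps poch by (simp add: power_mult_distrib power_divide field_simps del: of_nat_Suc)
  finally show ?thesis .
qed

text \<open>
  No restriction on \<open>w\<close> is needed: where \<open>w ^ m = n ^ m\<close> for some \<open>n \<ge> 1\<close>, the finite products
  are eventually \<open>0\<close> and so is the limit, by the conventions on division by zero and on poles of
  \<open>Gamma\<close>.
\<close>

lemma euler_prod_tendsto_gamma_prod:
  assumes m: "m \<ge> 2"
  shows "(\<lambda>N. euler_prod m N w) \<longlonglongrightarrow> gamma_prod m w"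
proof -
  have lim: "(\<lambda>N. (of_nat (Suc N) / of_nat N :: complex) ^ m *
          (\<Prod>r<m. Gamma_series (1 - w * ee (real r / real m)) N)) \<longlonglongrightarrow> 1 ^ m * gamma_prod m w"
    unfolding gamma_prod_def
    by (intro tendsto_intros LIMSEQ_Suc_n_over_n Gamma_series_LIMSEQ)
  have ev: "eventually (\<lambda>N. (of_nat (Suc N) / of_nat N :: complex) ^ m *
          (\<Prod>r<m. Gamma_series (1 - w * ee (real r / real m)) N) = euler_prod m (Suc N) w) sequentially"
    using eventually_gt_at_top[of 0]
  proof eventually_elim
    case (elim N)
    have "(of_nat (Suc N) / of_nat N :: complex) ^ m * (of_nat N / of_nat (Suc N)) ^ m = 1"
      using elim by (simp add: power_divide del: of_nat_Suc)
    thus ?case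
      by (simp only: prod_Gamma_series[OF m elim] mult.assoc [symmetric] mult_1)
  qed
  from Lim_transform_eventually[OF lim ev]
  have "(\<lambda>N. euler_prod m (Suc N) w) \<longlonglongrightarrow> gamma_prod m w"
    by simp
  thus ?thesis by (rule LIMSEQ_imp_Suc)
qed


section \<open>The finite products and the exponential of the zeta series\<close>

lemma bij_betw_Suc_atLeast_1: "bij_betw Suc UNIV {1..}"
  by (rule bij_betwI[of _ _ _ "\<lambda>n. n - 1"]) auto

lemma has_sum_geometric_pow2: "((\<lambda>j. (1 / 2) ^ j) has_sum (1 :: real)) {1..}"
proof -
  have "(\<lambda>j. (1 / 2 :: real) ^ Suc j) sums 1"
    by (rule power_half_series)
  hence "((\<lambda>j. (1 / 2 :: real) ^ Suc j) has_sum 1) UNIV"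
    by (rule sums_nonneg_imp_has_sum) auto
  also have "?this \<longleftrightarrow> ?thesis"
    by (rule has_sum_reindex_bij_betw[OF bij_betw_Suc_atLeast_1])
  finally show ?thesis .
qed

lemma summable_inverse_squares: "(\<lambda>n. 1 / real n ^ 2) summable_on {1..}"
proof (rule summable_on_subset_banach)
  show "(\<lambda>n. 1 / real n ^ 2) summable_on UNIV"
    using inverse_power_summable[of 2, where 'a = real]
    by (subst summable_on_UNIV_nonneg_real_iff) (simp_all add: field_simps)
qed auto

lemma zeta_of_nat: "zeta (of_nat s) = (\<Sum>\<^sub>\<infinity>n\<in>{1::nat..}. 1 / of_nat n ^ s)"
  unfolding zeta_def
  by (intro infsum_cong) (simp add: powr_minus powr_nat' field_simps)

text \<open>
  The square in the bound makes it summable over \<open>n\<close>; the factor \<open>1 / 2\<close> keeps \<open>w ^ m / n ^ m\<close> away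
  from \<open>1\<close>.
\<close>

lemma norm_power_divide_le:
  fixes n m :: nat
  assumes "n \<ge> 1" "m \<ge> 2" "norm (w :: complex) \<le> 1 / 2"
  shows "norm (w ^ m / of_nat n ^ m) \<le> 1 / 2 * (1 / real n ^ 2)"
proof -
  have "norm w ^ m \<le> norm w ^ 1"
    using assms by (intro power_decreasing) auto
  moreover have "1 / real n ^ m \<le> 1 / real n ^ 2"
    using assms by (intro divide_left_mono power_increasing) auto
  ultimately have "norm w ^ m * (1 / real n ^ m) \<le> 1 / 2 * (1 / real n ^ 2)"
    using assms by (intro mult_mono) auto
  thus ?thesis by (simp add: norm_divide norm_power)
qed

lemma norm_divide_of_nat_le: "norm (z / of_nat j :: complex) \<le> norm z"
proof (cases "j = 0")
  case False
  hence "norm z / real j \<le> norm z / 1"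
    by (intro divide_left_mono) auto
  thus ?thesis by (simp add: norm_divide)
qed auto

text \<open>
  The power series for \<open>Ln\<close> starts at \<open>j = 0\<close>, where its term is \<open>0\<close> as a division by zero.
\<close>

lemma has_sum_log_geometric:
  assumes "norm (u :: complex) < 1"
  shows "((\<lambda>j. u ^ j / of_nat j) has_sum (- Ln (1 - u))) {1::nat..}"
proof -
  have "(\<lambda>j. - (u ^ j / of_nat j)) sums Ln (1 - u)"
    using Ln_series'[of "-u"] assms by simp
  from sums_minus[OF this] have sums: "(\<lambda>j. u ^ j / of_nat j) sums (- Ln (1 - u))"
    by simp
  have "summable (\<lambda>j. norm (u ^ j / of_nat j))"
  proof (rule summable_comparison_test)
    show "summable (\<lambda>j. norm u ^ j)" using assms by (intro summable_geometric) auto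
    show "\<exists>N. \<forall>j\<ge>N. norm (norm (u ^ j / of_nat j)) \<le> norm u ^ j"
      using norm_divide_of_nat_le[of "u ^ j" j for j] by (simp add: norm_power)
  qed
  from norm_summable_imp_has_sum[OF this sums]
  show ?thesis
    by (rule has_sum_cong_neutral[THEN iffD1, rotated -1]) auto
qed

lemma euler_prod_tendsto_exp:
  assumes m: "m \<ge> 2" and w: "norm w \<le> 1 / 2"
  shows "(\<lambda>N. euler_prod m N w) \<longlonglongrightarrow>
           exp (\<Sum>\<^sub>\<infinity>j\<in>{1::nat..}. zeta (of_nat (m * j)) / of_nat j * w ^ (m * j))"
proof -
  define u :: "nat \<Rightarrow> complex" where "u = (\<lambda>n. w ^ m / of_nat n ^ m)"
  have u_bound: "norm (u n) \<le> 1 / 2 * (1 / real n ^ 2)" if "n \<ge> 1" for n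
    unfolding u_def using norm_power_divide_le[of n m w] that m w by simp
  have inv_le1: "1 / real n ^ 2 \<le> 1" if "n \<ge> 1" for n
    using that by (simp add: field_simps)
  have u_lt1: "norm (u n) < 1" if "n \<ge> 1" for n
    using u_bound[OF that] inv_le1[OF that] by linarith
  \<comment> \<open>The terms are dominated by those of a product of two convergent series,
      \<open>1 / n\<^sup>2\<close> and \<open>(1 / 2) ^ j\<close>; the latter sums to \<open>1\<close> over \<open>j \<ge> 1\<close>.\<close>
  have summable: "(\<lambda>(n, j). u n ^ j / of_nat j) summable_on ({1..} \<times> {1::nat..})"
  proof (rule abs_summable_summable, rule Infinite_Sum.abs_summable_on_comparison_test')
    have "(\<lambda>n. 1 / real n ^ 2 * 1) summable_on {1..}"
      using summable_inverse_squares by simp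
    moreover have "((\<lambda>j. (case (n, j) of (n, j) \<Rightarrow> 1 / real n ^ 2 * (1 / 2) ^ j)) has_sum
        (1 / real n ^ 2 * 1)) {1::nat..}" for n
      unfolding prod.case by (intro has_sum_cmult_right has_sum_geometric_pow2)
    ultimately show "(\<lambda>(n, j). 1 / real n ^ 2 * (1 / 2) ^ j) summable_on ({1..} \<times> {1::nat..})"
      by (intro summable_on_SigmaI) auto
  next
    fix p :: "nat \<times> nat" assume "p \<in> {1..} \<times> {1..}"
    then obtain n j where p: "p = (n, j)" and n: "n \<ge> 1" and j: "j \<ge> 1" by auto
    have "norm (u n ^ j / of_nat j) \<le> norm (u n) ^ j"
      using norm_divide_of_nat_le[of "u n ^ j" j] by (simp add: norm_power)
    also have "\<dots> \<le> (1 / 2 * (1 / real n ^ 2)) ^ j"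
      by (intro power_mono u_bound n) auto
    also have "\<dots> = (1 / 2) ^ j * (1 / real n ^ 2) ^ j"
      by (rule power_mult_distrib)
    also have "\<dots> \<le> (1 / 2) ^ j * (1 / real n ^ 2) ^ 1"
      by (intro mult_left_mono power_decreasing j inv_le1 n) auto
    finally show "norm (case p of (n, j) \<Rightarrow> u n ^ j / of_nat j) \<le>
                    (case p of (n, j) \<Rightarrow> 1 / real n ^ 2 * (1 / 2) ^ j)"
      by (simp add: p mult.commute)
  qed
  define S where "S = (\<Sum>\<^sub>\<infinity>j\<in>{1::nat..}. zeta (of_nat (m * j)) / of_nat j * w ^ (m * j))"
  have "S = (\<Sum>\<^sub>\<infinity>j\<in>{1::nat..}. \<Sum>\<^sub>\<infinity>n\<in>{1::nat..}. u n ^ j / of_nat j)"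
    unfolding S_def
  proof (rule infsum_cong)
    fix j :: nat
    have "zeta (of_nat (m * j)) / of_nat j * w ^ (m * j) =
            (\<Sum>\<^sub>\<infinity>n\<in>{1::nat..}. 1 / of_nat n ^ (m * j) * (w ^ (m * j) / of_nat j))"
      unfolding zeta_of_nat infsum_cmult_left' by simp
    also have "\<dots> = (\<Sum>\<^sub>\<infinity>n\<in>{1::nat..}. u n ^ j / of_nat j)"
      by (intro infsum_cong) (simp add: u_def power_divide power_mult)
    finally show "zeta (of_nat (m * j)) / of_nat j * w ^ (m * j) =
            (\<Sum>\<^sub>\<infinity>n\<in>{1::nat..}. u n ^ j / of_nat j)" .
  qed
  also have "\<dots> = (\<Sum>\<^sub>\<infinity>n\<in>{1::nat..}. \<Sum>\<^sub>\<infinity>j\<in>{1::nat..}. u n ^ j / of_nat j)"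
    by (rule infsum_swap_banach[OF summable, symmetric])
  finally have S: "S = \<dots>" .
  have inner: "(\<Sum>\<^sub>\<infinity>j\<in>{1::nat..}. u n ^ j / of_nat j) = - Ln (1 - u n)" if "n \<ge> 1" for n
    by (intro infsumI has_sum_log_geometric u_lt1 that)
  have "(\<lambda>n. \<Sum>\<^sub>\<infinity>j\<in>{1::nat..}. u n ^ j / of_nat j) summable_on {1..}"
    using summable_on_Sigma_banach[OF summable] by simp
  hence "((\<lambda>n. \<Sum>\<^sub>\<infinity>j\<in>{1::nat..}. u n ^ j / of_nat j) has_sum S) {1..}"
    unfolding S by (rule has_sum_infsum)
  hence "((\<lambda>n. - Ln (1 - u n)) has_sum S) {1..}"
    by (rule has_sum_cong[THEN iffD1, rotated]) (use inner in auto)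
  also have "?this \<longleftrightarrow> ((\<lambda>n. - Ln (1 - u (Suc n))) has_sum S) UNIV"
    by (rule has_sum_reindex_bij_betw[OF bij_betw_Suc_atLeast_1, symmetric])
  finally have "(\<lambda>n. - Ln (1 - u (Suc n))) sums S"
    by (rule has_sum_imp_sums)
  hence "(\<lambda>N. exp (\<Sum>n<N. - Ln (1 - u (Suc n)))) \<longlonglongrightarrow> exp S"
    unfolding sums_def by (intro tendsto_exp)
  also have "(\<lambda>N. exp (\<Sum>n<N. - Ln (1 - u (Suc n)))) = (\<lambda>N. euler_prod m N w)"
  proof
    fix N
    have "exp (- Ln (1 - u (Suc n))) = inverse (1 - 1 / of_nat (Suc n) ^ m * w ^ m)" for n
    proof -
      have "1 - u (Suc n) \<noteq> 0" using u_lt1[of "Suc n"] by auto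
      thus ?thesis by (simp add: exp_minus u_def)
    qed
    thus "exp (\<Sum>n<N. - Ln (1 - u (Suc n))) = euler_prod m N w"
      by (simp add: exp_sum euler_prod_def)
  qed
  finally show ?thesis unfolding S_def .
qed

section \<open>Locally uniform convergence and convergence of coefficients\<close>

lemma euler_factor_bounds:
  fixes m :: nat
  assumes "m \<ge> 2" "norm (w :: complex) \<le> 1 / 2"
  shows "norm (1 / of_nat (Suc n) ^ m * w ^ m) \<le> 1 / 2 * (1 / real (Suc n) ^ 2)"
        "1 / of_nat (Suc n) ^ m * w ^ m \<noteq> 1"
proof -
  show *: "norm (1 / of_nat (Suc n) ^ m * w ^ m) \<le> 1 / 2 * (1 / real (Suc n) ^ 2)"
    using norm_power_divide_le[of "Suc n" m w] assms by simp
  have "1 / real (Suc n) ^ 2 \<le> 1 / 1"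
    by (intro divide_left_mono one_le_power) auto
  with * have "norm (1 / of_nat (Suc n) ^ m * w ^ m) < 1"
    by linarith
  thus "1 / of_nat (Suc n) ^ m * w ^ m \<noteq> 1"
    by (metis norm_one less_irrefl)
qed

lemma uniform_limit_euler_prod:
  assumes m: "m \<ge> 2"
  shows "uniform_limit (cball 0 (1 / 2)) (euler_prod m) (gamma_prod m) sequentially"
proof -
  let ?u = "\<lambda>n w :: complex. 1 / of_nat (Suc n) ^ m * w ^ m"
  have "uniformly_convergent_on (cball 0 (1 / 2)) (\<lambda>N w. \<Prod>n<N. inverse (1 - ?u n w))"
  proof (rule uniformly_convergent_on_prod')
    show "continuous_on (cball 0 (1 / 2)) (\<lambda>w. inverse (1 - ?u n w))" for n
      using euler_factor_bounds(2)[OF m] by (intro continuous_intros) auto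
    show "uniformly_convergent_on (cball 0 (1 / 2)) (\<lambda>N w. \<Sum>n<N. norm (inverse (1 - ?u n w) - 1))"
    proof (rule Weierstrass_m_test')
      show "summable (\<lambda>n. 1 / real (Suc n) ^ 2)"
        using inverse_power_summable[of 2, where 'a = real]
        by (subst summable_Suc_iff) (simp add: field_simps)
      fix n and w :: complex assume "w \<in> cball 0 (1 / 2)"
      hence w: "norm w \<le> 1 / 2" by simp
      note u = euler_factor_bounds[OF m w, of n]
      have "1 / real (Suc n) ^ 2 \<le> 1" by (simp add: field_simps)
      hence half: "norm (?u n w) \<le> 1 / 2" using u(1) by linarith
      have "1 - norm (?u n w) \<le> norm (1 - ?u n w)"
        by (metis norm_one norm_triangle_ineq2)
      hence ge: "1 / 2 \<le> norm (1 - ?u n w)" using half by linarith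
      have inv: "inverse (1 - x) - 1 = x / (1 - x)" if "x \<noteq> 1" for x :: complex
        using that by (simp add: field_simps)
      have "inverse (1 - ?u n w) - 1 = ?u n w / (1 - ?u n w)"
        by (rule inv) (rule u)
      \<comment> \<open>Since \<open>1 - u\<close> has norm at least \<open>1 / 2\<close>, the distance of the factor to \<open>1\<close> is at most
          twice the norm of \<open>u\<close>.\<close>
      hence "norm (inverse (1 - ?u n w) - 1) = norm (?u n w) / norm (1 - ?u n w)"
        by (simp only: norm_divide)
      also have "\<dots> \<le> (1 / 2 * (1 / real (Suc n) ^ 2)) / (1 / 2)"
        by (intro frac_le u ge) auto
      finally show "norm (norm (inverse (1 - ?u n w) - 1)) \<le> 1 / real (Suc n) ^ 2"
        by simp
    qed
  qed auto
  then obtain g where g: "uniform_limit (cball 0 (1 / 2)) (euler_prod m) g sequentially"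
    unfolding uniformly_convergent_on_def euler_prod_def by blast
  have "g w = gamma_prod m w" if "w \<in> cball 0 (1 / 2)" for w
    using LIMSEQ_unique[OF tendsto_uniform_limitI[OF g that] euler_prod_tendsto_gamma_prod[OF m]] .
  with uniform_limit_cong'[of "cball 0 (1 / 2)" "euler_prod m" "euler_prod m" g "gamma_prod m"] g
  show ?thesis by blast
qed

lemma euler_prod_holomorphic:
  assumes "m \<ge> 2"
  shows "euler_prod m N holomorphic_on ball 0 (1 / 2)"
  unfolding euler_prod_def
  using euler_factor_bounds(2)[OF assms] by (intro holomorphic_intros) auto

lemma gamma_prod_analytic:
  assumes m: "m \<ge> 2"
  shows "gamma_prod m analytic_on {0}"
proof -
  have "gamma_prod m holomorphic_on ball 0 (1 / 2)"
  proof (rule holomorphic_uniform_sequence)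
    fix x :: complex assume "x \<in> ball 0 (1 / 2)"
    then obtain d where d: "d > 0" "cball x d \<subseteq> ball 0 (1 / 2)"
      by (meson open_ball open_contains_cball)
    moreover have "cball x d \<subseteq> cball 0 (1 / 2)"
      using d(2) ball_subset_cball by blast
    ultimately show "\<exists>d>0. cball x d \<subseteq> ball 0 (1 / 2) \<and>
                       uniform_limit (cball x d) (euler_prod m) (gamma_prod m) sequentially"
      using uniform_limit_on_subset[OF uniform_limit_euler_prod[OF m]] by blast
  qed (use euler_prod_holomorphic[OF m] in auto)
  thus ?thesis
    by (auto simp: analytic_at intro!: exI[of _ "ball 0 (1 / 2)"])
qed

lemma complete_sym_tendsto_taylor_coeff:
  assumes m: "m \<ge> 2"
  shows "(\<lambda>N. complete_sym (\<lambda>n. 1 / of_nat n ^ m) N k) \<longlonglongrightarrow>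
           taylor_coeff (m * k) (gamma_prod m)"
proof -
  have "uniform_limit (ball 0 (1 / 2)) (euler_prod m) (gamma_prod m) sequentially"
    by (rule uniform_limit_on_subset[OF uniform_limit_euler_prod[OF m]]) auto
  hence "(\<lambda>N. (deriv ^^ (m * k)) (euler_prod m N) 0) \<longlonglongrightarrow> (deriv ^^ (m * k)) (gamma_prod m) 0"
    by (rule higher_deriv_complex_uniform_limit) (use euler_prod_holomorphic[OF m] in auto)
  hence "(\<lambda>N. taylor_coeff (m * k) (euler_prod m N)) \<longlonglongrightarrow> taylor_coeff (m * k) (gamma_prod m)"
    unfolding taylor_coeff_def fps_expansion_def fps_nth_Abs_fps by (intro tendsto_divide) auto
  moreover have "taylor_coeff (m * k) (euler_prod m N) = complete_sym (\<lambda>n. 1 / of_nat n ^ m) N k" for N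
  proof -
    have "euler_prod m N has_fps_expansion
            (Abs_fps (complete_sym (\<lambda>n. 1 / of_nat n ^ m) N) oo fps_X ^ m)"
      unfolding euler_prod_def
      using has_fps_expansion_prod_geometric[of m "\<lambda>n. 1 / of_nat n ^ m" N] m by simp
    thus ?thesis
      using m by (simp add: taylor_coeff_eqI fps_nth_compose_X_power)
  qed
  ultimately show ?thesis by simp
qed

section \<open>The partition zeta value as a limit of finite sums\<close>

text \<open>
  Convergence along the partitions with parts at most \<open>N\<close> suffices for the unordered sum over all
  partitions: the terms are nonnegative, so every finite partial sum is bounded by the limit, and
  every finite set of partitions has bounded parts.
\<close>

lemma zeta_P_eq_lim_complete_sym:
  assumes lim: "(\<lambda>N. complete_sym (\<lambda>n. 1 / of_nat n ^ s) N k) \<longlonglongrightarrow> (L :: complex)"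
  shows "zeta_P (of_nat s) k = L"
proof -
  define P where "P = {ps. integer_partition ps \<and> length ps = k}"
  define t where "t = (\<lambda>ps. 1 / real (prod_list ps) ^ s)"
  have term_eq: "prod_list (map (\<lambda>n. 1 / of_nat n ^ s) ps) = (of_real (t ps) :: complex)" for ps
    by (induction ps) (simp_all add: t_def power_mult_distrib)
  have sum_eq: "complete_sym (\<lambda>n. 1 / of_nat n ^ s) N k =
                  (\<Sum>ps\<in>bounded_partitions N k. of_real (t ps) :: complex)" for N
    unfolding complete_sym_def by (intro sum.cong refl term_eq)
  have lim': "(\<lambda>N. \<Sum>ps\<in>bounded_partitions N k. t ps) \<longlonglongrightarrow> Re L"
    using tendsto_Re[OF lim] by (simp add: sum_eq)
  have exhaust: "eventually (\<lambda>N. F \<subseteq> bounded_partitions N k) sequentially"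
    if F: "finite F" "F \<subseteq> P" for F
  proof -
    have "finite (\<Union>ps\<in>F. set ps)" using F by auto
    then obtain M where "\<Union>(set ` F) \<subseteq> {..M}"
      using finite_nat_iff_bounded_le by auto
    hence "F \<subseteq> bounded_partitions N k" if "N \<ge> M" for N
      using F that by (fastforce simp: bounded_partitions_def P_def)
    thus ?thesis
      by (auto simp: eventually_at_top_linorder)
  qed
  have "t summable_on P"
  proof (rule nonneg_bdd_above_summable_on)
    show "bdd_above (sum t ` {F. F \<subseteq> P \<and> finite F})"
    proof (rule bdd_aboveI2)
      fix F assume F: "F \<in> {F. F \<subseteq> P \<and> finite F}"
      have "eventually (\<lambda>N. sum t F \<le> (\<Sum>ps\<in>bounded_partitions N k. t ps)) sequentially"
        using F
        by (intro eventually_mono[OF exhaust[of F]] sum_mono2) (auto simp: t_def)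
      thus "sum t F \<le> Re L"
        by (rule tendsto_lowerbound[OF lim']) auto
    qed
  qed (auto simp: t_def)
  hence "(\<lambda>ps. of_real (t ps) :: complex) summable_on P"
    by (rule summable_on_of_real)
  hence "(sum (\<lambda>ps. of_real (t ps)) \<longlongrightarrow> (\<Sum>\<^sub>\<infinity>ps\<in>P. of_real (t ps) :: complex)) (finite_subsets_at_top P)"
    by (simp add: has_sum_infsum flip: has_sum_def)
  moreover have "filterlim (\<lambda>N. bounded_partitions N k) (finite_subsets_at_top P) sequentially"
    unfolding filterlim_finite_subsets_at_top
  proof (intro allI impI)
    fix F assume "finite F \<and> F \<subseteq> P"
    hence "eventually (\<lambda>N. F \<subseteq> bounded_partitions N k) sequentially"
      using exhaust by blast
    moreover have "bounded_partitions N k \<subseteq> P" for N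
      by (auto simp: bounded_partitions_def P_def)
    ultimately show "eventually (\<lambda>N. finite (bounded_partitions N k) \<and>
        F \<subseteq> bounded_partitions N k \<and> bounded_partitions N k \<subseteq> P) sequentially"
      by (simp add: finite_bounded_partitions)
  qed
  ultimately have "(\<lambda>N. \<Sum>ps\<in>bounded_partitions N k. of_real (t ps)) \<longlonglongrightarrow> (\<Sum>\<^sub>\<infinity>ps\<in>P. of_real (t ps) :: complex)"
    by (rule filterlim_compose)
  hence "L = (\<Sum>\<^sub>\<infinity>ps\<in>P. of_real (t ps))"
    using lim unfolding sum_eq by (rule LIMSEQ_unique[rotated])
  also have "\<dots> = zeta_P (of_nat s) k"
    unfolding zeta_P_def P_def [symmetric]
  proof (rule infsum_cong)
    fix ps assume "ps \<in> P"
    hence "prod_list ps \<noteq> 0"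
      by (auto simp: P_def integer_partition_def prod_list_zero_iff)
    thus "of_real (t ps) = (of_nat (prod_list ps) powr (- of_nat s) :: complex)"
      by (simp add: t_def powr_minus powr_nat' field_simps)
  qed
  finally show ?thesis ..
qed

section \<open>The generating function of the partition zeta values\<close>

theorem theorem3:
  fixes m k :: nat
  assumes "m \<ge> 2" and "k \<ge> 1"
  shows "zeta_P (of_nat m) k =
           of_real pi ^ (m * k) *
           taylor_coeff (m * k)
             (\<lambda>z. \<Prod>r<m. Gamma (1 - z / of_real pi * ee (real r / real m))) \<and>
         of_real pi ^ (m * k) *
           taylor_coeff (m * k)
             (\<lambda>z. \<Prod>r<m. Gamma (1 - z / of_real pi * ee (real r / real m))) =
         of_real pi ^ (m * k) *
           taylor_coeff (m * k)
             (\<lambda>z. exp (\<Sum>\<^sub>\<infinity>j\<in>{1::nat..}.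
                      zeta (of_nat (m * j)) / of_nat j * (z / of_real pi) ^ (m * j)))"
proof -
  let ?G = "\<lambda>z. \<Prod>r<m. Gamma (1 - z / of_real pi * ee (real r / real m))"
  let ?E = "\<lambda>z. exp (\<Sum>\<^sub>\<infinity>j\<in>{1::nat..}.
                      zeta (of_nat (m * j)) / of_nat j * (z / of_real pi) ^ (m * j))"
  have "zeta_P (of_nat m) k = taylor_coeff (m * k) (gamma_prod m)"
    using complete_sym_tendsto_taylor_coeff[OF assms(1)] by (rule zeta_P_eq_lim_complete_sym)
  also have "\<dots> = of_real pi ^ (m * k) * taylor_coeff (m * k) (\<lambda>z. gamma_prod m (z / of_real pi))"
    using taylor_coeff_divide[OF gamma_prod_analytic[OF assms(1)]] by simp
  also have "(\<lambda>z. gamma_prod m (z / of_real pi)) = ?G"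
    by (simp add: gamma_prod_def)
  finally have 1: "zeta_P (of_nat m) k = of_real pi ^ (m * k) * taylor_coeff (m * k) ?G" .
  have "eventually (\<lambda>z :: complex. z \<in> ball 0 (pi / 2)) (nhds 0)"
    by (rule eventually_nhds_in_open) auto
  hence "eventually (\<lambda>z. ?G z = ?E z) (nhds 0)"
  proof eventually_elim
    case (elim z)
    hence "norm (z / of_real pi) \<le> 1 / 2"
      by (simp add: norm_divide field_simps)
    from LIMSEQ_unique[OF euler_prod_tendsto_gamma_prod[OF assms(1)]
                          euler_prod_tendsto_exp[OF assms(1) this]]
    show ?case by (simp add: gamma_prod_def)
  qed
  hence 2: "taylor_coeff (m * k) ?G = taylor_coeff (m * k) ?E"
    by (rule taylor_coeff_cong)
  from 1 2 show ?thesis by simp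
qed

end
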